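(* Let $k$ be a positive integer. Then the square matrix $A_k^{k-2}$ is persymmetric, and it is similar to its transpose $(A_k^{k-2})^t$ by a permutation of rows and columns, i.e. there is a permutation matrix $P$ with $P^{-1}A_k^{k-2}P=(A_k^{k-2})^t$.
   Context: $C^a_b$ denotes the binomial coefficient "$a$ choose $b$". For an $m\times n$ matrix $A=(a_{ij})$, the flip-transpose ${}^tA$ is the reflection of $A$ across its skew-diagonal, i.e. the $n\times m$ matrix whose $(i,j)$ entry is $a_{m-j+1,\,n-i+1}$; $A$ is persymmetric if ${}^tA=A$. The ordinary transpose is written $A^t$. $I_p$ is the $p\times p$ identity matrix. If $X$ has $m$ columns and $Y$ is $m\times m$, then $X(Y)$ denotes the matrix obtained by pasting $Y$ below $X$. If $X$ is $n_1\times m_1$ and $Y$ is $n_2\times m_2$ with $n_1\ge n_2$, then $X\sqcup Y$ is the $n_1\times(m_1+m_2)$ matrix obtained by placing $Y$ to the right of $X$ with the bottom rows aligned and filling the remaining upper right $(n_1-n_2)\times m_2$ block with zeros; longer expressions are formed from left to right. For $k\ge 1$, $\underline{k}$ is the $1\times k$ matrix filled with ones. The matrices $A_k^{j}$ ($k\ge1$, $j\ge -1$) are defined by $A_k^{-1}=\underline{k}$ and, for $j\ge 0$, $A_k^{j}=A_k^{j-1}(I_{C^{k+j}_{j+1}})\sqcup A_{k-1}^{j-1}(I_{C^{k-1+j}_{j+1}})\sqcup\cdots\sqcup A_1^{j-1}(I_{C^{1+j}_{j+1}})$, where each identity matrix has as many rows as the matrix above it has columns. The matrix $A_k^{k-2}$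 has order $C^{2k-1}_{k-1}\times C^{2k-1}_{k}$, hence is square. *)

theory Defs
  imports "Jordan_Normal_Form.Matrix" "HOL-Combinatorics.Permutations"
begin

text \<open>Matrix indices of the library start at 0, so the 1-based index \<open>m - j + 1\<close> becomes \<open>m - 1 - j\<close>.\<close>

definition flip_transpose :: "'a mat \<Rightarrow> 'a mat" where
  "flip_transpose A = mat (dim_col A) (dim_row A)
     (\<lambda>(i, j). A $$ (dim_row A - 1 - j, dim_col A - 1 - i))"

definition persymmetric :: "'a mat \<Rightarrow> bool" where
  "persymmetric A \<longleftrightarrow> flip_transpose A = A"

definition permutation_matrix :: "'a :: {zero, one} mat \<Rightarrow> bool" where
  "permutation_matrix P \<longleftrightarrow>
     (\<exists>n \<sigma>. \<sigma> permutes {..<n} \<and> P = mat n n (\<lambda>(i, j). if i = \<sigma> j then 1 else 0))"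

text \<open>Juxtaposition aligned at the bottom; only meaningful if \<open>dim_row Y \<le> dim_row X\<close>.\<close>

definition join_bottom :: "'a :: zero mat \<Rightarrow> 'a mat \<Rightarrow> 'a mat" (infixl \<open>\<squnion>\<^sub>m\<close> 65) where
  "X \<squnion>\<^sub>m Y = mat (dim_row X) (dim_col X + dim_col Y)
     (\<lambda>(i, j). if j < dim_col X then X $$ (i, j)
               else if i < dim_row X - dim_row Y then 0
               else Y $$ (i - (dim_row X - dim_row Y), j - dim_col X))"

definition ones_row :: "nat \<Rightarrow> int mat" where
  "ones_row k = mat 1 k (\<lambda>_. 1)"

text \<open>\<open>A_mat k j\<close> is the matrix \<open>A\<^sub>k\<^sup>j\<close> for \<open>k \<ge> 1\<close> and \<open>j \<ge> -1\<close>; the values for \<open>j < -1\<close> and for \<open>k = 0\<close>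
  are irrelevant. The list \<open>rev [1..<k]\<close> is \<open>k - 1, ..., 1\<close>, and \<open>foldl\<close> brackets to the left.\<close>

function A_mat :: "nat \<Rightarrow> int \<Rightarrow> int mat" where
  "A_mat k j =
     (if j < 0 then ones_row k
      else foldl (\<squnion>\<^sub>m)
        (A_mat k (j - 1) @\<^sub>r 1\<^sub>m ((k + nat j) choose (nat j + 1)))
        (map (\<lambda>i. A_mat i (j - 1) @\<^sub>r 1\<^sub>m ((i + nat j) choose (nat j + 1))) (rev [1..<k])))"
  by auto
termination
  by (relation "measure (\<lambda>(k, j). nat (j + 1))") auto

declare A_mat.simps [simp del]

lemma dim_foldl_join_bottom:
  "dim_row (foldl (\<squnion>\<^sub>m) X Ys) = dim_row X"
  "dim_col (foldl (\<squnion>\<^sub>m) X Ys) = dim_col X + sum_list (map dim_col Ys)"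
  by (induction Ys arbitrary: X) (auto simp: join_bottom_def)

lemma sum_list_rev_upt: "sum_list (map f (rev [1..<k])) = sum f {1..<k}" for f :: "nat \<Rightarrow> nat"
  by (metis interv_sum_list_conv_sum_set_nat rev_map set_upt sum_list_rev)

lemma sum_choose_shift: "(\<Sum>i = 1..<k. (i + n) choose (n + 1)) = (k + n) choose (n + 2)"
  by (induction k) (auto simp: sum.atLeastLessThan_Suc add.commute)

text \<open>In particular, in the recursion every identity matrix fits below its partner, and the row
  numbers of the pasted matrices decrease from left to right.\<close>

lemma A_mat_carrier:
  assumes "k \<ge> 1"
  shows "A_mat k (int n - 1) \<in> carrier_mat ((k + n) choose n) ((k + n) choose (n + 1))"
  using assms
proof (induction n arbitrary: k)
  case 0
  then show ?case by (simp add: A_mat.simps ones_row_def)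
next
  case (Suc n)
  let ?B = "\<lambda>i. A_mat i (int n - 1) @\<^sub>r 1\<^sub>m ((i + n) choose (n + 1))"
  have B: "?B i \<in> carrier_mat (((i + n) choose n) + ((i + n) choose (n + 1))) ((i + n) choose (n + 1))"
    if "i \<ge> 1" for i
    by (rule carrier_append_rows[OF Suc.IH[OF that] one_carrier_mat])
  have A: "A_mat k (int (Suc n) - 1) = foldl (\<squnion>\<^sub>m) (?B k) (map ?B (rev [1..<k]))"
    by (subst A_mat.simps) simp
  have "sum_list (map dim_col (map ?B (rev [1..<k]))) = (\<Sum>i = 1..<k. dim_col (?B i))"
    by (simp only: map_map o_def sum_list_rev_upt)
  also have "\<dots> = (\<Sum>i = 1..<k. (i + n) choose (n + 1))"
    using B by (intro sum.cong) auto
  also have "\<dots> = (k + n) choose (n + 2)"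
    by (rule sum_choose_shift)
  finally have "dim_col (A_mat k (int (Suc n) - 1)) = (k + Suc n) choose (Suc n + 1)"
    using B[OF Suc.prems] unfolding A dim_foldl_join_bottom by auto
  moreover have "dim_row (A_mat k (int (Suc n) - 1)) = (k + Suc n) choose Suc n"
    using B[OF Suc.prems] unfolding A dim_foldl_join_bottom by auto
  ultimately show ?case by auto
qed

lemma A_mat_square_order:
  assumes "k \<ge> 1"
  shows "A_mat k (int k - 2) \<in> carrier_mat ((2 * k - 1) choose (k - 1)) ((2 * k - 1) choose k)"
proof -
  have "int (k - 1) - 1 = int k - 2" "k + (k - 1) = 2 * k - 1" "k - 1 + 1 = k"
    using assms by auto
  then show ?thesis
    using A_mat_carrier[OF assms, of "k - 1"] by metis
qed

end

theory Submission
  imports Defs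
begin

text \<open>Peeling off the first column block turns the recursion into
  \<open>A\<^sub>k\<^sup>j = ((A\<^sub>k\<^sup>j\<^sup>-\<^sup>1, 0), (I, A\<^sub>k\<^sub>-\<^sub>1\<^sup>j))\<close>. The flip-transpose exchanges the two diagonal blocks,
  so by induction it maps \<open>A\<^sub>k\<^sup>j\<close> to the matrix with upper index \<open>k - 2\<close> and lower index \<open>j + 2\<close>;
  for \<open>j = k - 2\<close> this is the same matrix. For any square matrix, persymmetry says that
  conjugation with the reversal permutation yields the transpose.\<close>

text \<open>The row bounds keep the subtractions in \<open>join_bottom\<close> from truncating: the
  offset of \<open>Z\<close> inside \<open>Y\<close> plus that of \<open>Y\<close> inside
  \<open>X\<close> is then the offset of \<open>Z\<close> inside \<open>X\<close>.\<close>

lemma join_bottom_assoc: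
  assumes "dim_row Z \<le> dim_row Y" "dim_row Y \<le> dim_row X"
  shows "X \<squnion>\<^sub>m Y \<squnion>\<^sub>m Z = X \<squnion>\<^sub>m (Y \<squnion>\<^sub>m Z)"
  by (rule eq_matI) (use assms in \<open>auto simp: join_bottom_def\<close>)

lemma foldl_join_bottom:
  assumes "dim_row Y \<le> dim_row X" "\<And>Z. Z \<in> set Zs \<Longrightarrow> dim_row Z \<le> dim_row Y"
  shows "foldl (\<squnion>\<^sub>m) (X \<squnion>\<^sub>m Y) Zs = X \<squnion>\<^sub>m foldl (\<squnion>\<^sub>m) Y Zs"
  using assms(2)
proof (induction Zs rule: rev_induct)
  case (snoc Z Zs)
  then show ?case
    using assms(1) by (simp add: join_bottom_assoc dim_foldl_join_bottom)
qed simp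

lemma append_rows_join_bottom:
  assumes "A \<in> carrier_mat r c" "D \<in> carrier_mat s d" "C \<in> carrier_mat s c"
  shows "(A @\<^sub>r C) \<squnion>\<^sub>m D = four_block_mat A (0\<^sub>m r d) C D"
  by (rule eq_matI) (use assms in \<open>auto simp: join_bottom_def append_rows_def\<close>)

text \<open>By associativity, all column blocks after the first form
  \<open>A_mat (Suc m) (int n)\<close>. By Pascal's rule it has as many rows as the identity has, so
  the zero padding fills exactly the corner beside the upper left block.\<close>

lemma A_mat_Suc_Suc:
  "A_mat (Suc (Suc m)) (int n) =
     four_block_mat (A_mat (Suc (Suc m)) (int n - 1))
       (0\<^sub>m ((m + n + 2) choose n) ((m + n + 2) choose (n + 2)))
       (1\<^sub>m ((m + n + 2) choose (n + 1)))
       (A_mat (Suc m) (int n))"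
proof -
  have car: "A_mat (Suc (Suc m)) (int n - 1) \<in>
      carrier_mat ((m + n + 2) choose n) ((m + n + 2) choose (n + 1))"
    "A_mat (Suc m) (int n) \<in>
      carrier_mat ((m + n + 2) choose (n + 1)) ((m + n + 2) choose (n + 2))"
    using A_mat_carrier[of "Suc (Suc m)" n] A_mat_carrier[of "Suc m" "Suc n"]
    by (simp_all del: binomial_Suc_Suc)
  let ?B = "\<lambda>i. A_mat i (int n - 1) @\<^sub>r 1\<^sub>m ((i + n) choose (n + 1))"
  have A: "A_mat k (int n) = foldl (\<squnion>\<^sub>m) (?B k) (map ?B (rev [1..<k]))" for k
    by (subst A_mat.simps) simp
  \<comment> \<open>Merging the two summands into one binomial makes monotonicity in
    \<open>i\<close> immediate.\<close>
  have row: "dim_row (?B i) = Suc (i + n) choose Suc n" if "i \<ge> 1" for i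
    using carrier_append_rows[OF A_mat_carrier[OF that, of n] one_carrier_mat] by simp
  have mono: "dim_row (?B i) \<le> dim_row (?B l)" if "1 \<le> i" "i \<le> l" for i l
    unfolding row[OF that(1)] row[OF order_trans[OF that]]
    using that by (intro binomial_right_mono) auto
  have "A_mat (Suc (Suc m)) (int n) =
      foldl (\<squnion>\<^sub>m) (?B (Suc (Suc m)) \<squnion>\<^sub>m ?B (Suc m)) (map ?B (rev [1..<Suc m]))"
    by (subst A) simp
  also have "\<dots> = ?B (Suc (Suc m)) \<squnion>\<^sub>m A_mat (Suc m) (int n)"
    unfolding A[of "Suc m"]
  proof (rule foldl_join_bottom)
    show "dim_row (?B (Suc m)) \<le> dim_row (?B (Suc (Suc m)))"
      by (rule mono) simp_all
    fix Z assume "Z \<in> set (map ?B (rev [1..<Suc m]))"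
    then obtain i where "i \<in> {1..<Suc m}" and Z: "Z = ?B i"
      unfolding set_map set_rev set_upt by blast
    then show "dim_row Z \<le> dim_row (?B (Suc m))"
      unfolding Z by (intro mono) simp_all
  qed
  also have "\<dots> = four_block_mat (A_mat (Suc (Suc m)) (int n - 1))
       (0\<^sub>m ((m + n + 2) choose n) ((m + n + 2) choose (n + 2)))
       (1\<^sub>m ((m + n + 2) choose (n + 1))) (A_mat (Suc m) (int n))"
    using append_rows_join_bottom[OF car one_carrier_mat] by simp
  finally show ?thesis .
qed

lemma flip_transpose_four_block_mat:
  assumes "A \<in> carrier_mat r c" "B \<in> carrier_mat r d" "C \<in> carrier_mat s c" "D \<in> carrier_mat s d"
  shows "flip_transpose (four_block_mat A B C D) =
    four_block_mat (flip_transpose D) (flip_transpose B) (flip_transpose C) (flip_transpose A)"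
proof (rule eq_matI, goal_cases)
  case (1 i j)
  then have "i < d + c" "j < s + r"
    using assms by (auto simp: flip_transpose_def)
  then show ?case
    using assms
    \<comment> \<open>In each quadrant both sides read the same block, so only the index pairs
      remain to be compared.\<close>
    by (auto simp: flip_transpose_def intro!: arg_cong[where f = "($$) _"])
qed (use assms in \<open>auto simp: flip_transpose_def\<close>)

lemma flip_transpose_zero: "flip_transpose (0\<^sub>m r c) = 0\<^sub>m c r"
  by (rule eq_matI) (auto simp: flip_transpose_def)

lemma flip_transpose_one: "flip_transpose (1\<^sub>m n) = 1\<^sub>m n"
  by (rule eq_matI) (auto simp: flip_transpose_def)

text \<open>For \<open>k = 1\<close> nothing is joined on the right, and each step pastes a single 1
  below the column.\<close>

lemma A_mat_1: "A_mat (Suc 0) (int n - 1) = mat (Suc n) 1 (\<lambda>_. 1)"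
proof (induction n)
  case 0
  show ?case by (simp add: A_mat.simps ones_row_def)
next
  case (Suc n)
  have "A_mat (Suc 0) (int (Suc n) - 1) = mat (Suc n) 1 (\<lambda>_. 1) @\<^sub>r 1\<^sub>m 1"
    by (subst A_mat.simps) (simp add: Suc)
  also have "\<dots> = mat (Suc (Suc n)) 1 (\<lambda>_. 1)"
    by (rule eq_matI) (auto simp: append_rows_def)
  finally show ?case .
qed

text \<open>With \<open>k = m + 1\<close> and \<open>j = n - 1\<close>, the index change from
  \<open>(k, j)\<close> to \<open>(j + 2, k - 2)\<close> is the swap of \<open>m\<close> and
  \<open>n\<close>. On the boundary, a row of ones is exchanged with a column of ones; otherwise
  both diagonal blocks have smaller \<open>m + n\<close>.\<close>

lemma flip_transpose_A_mat:
  "flip_transpose (A_mat (Suc m) (int n - 1)) = A_mat (Suc n) (int m - 1)"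
proof (induction "m + n" arbitrary: m n rule: less_induct)
  case less
  have ones: "A_mat (Suc l) (- 1) = mat 1 (Suc l) (\<lambda>_. 1)" for l
    by (simp add: A_mat.simps ones_row_def)
  consider "m = 0" | "n = 0" | m' n' where "m = Suc m'" "n = Suc n'"
    by (metis not0_implies_Suc)
  then show ?case
  proof cases
    case 1
    then show ?thesis
      using A_mat_1[of n] by (auto simp: flip_transpose_def ones)
  next
    case 2
    then show ?thesis
      using A_mat_1[of m] by (auto simp: flip_transpose_def ones)
  next
    case 3
    have IH1: "flip_transpose (A_mat (Suc m') (int n')) = A_mat (Suc (Suc n')) (int m' - 1)"
      using less[of m' n] 3 by simp
    have IH2: "flip_transpose (A_mat (Suc (Suc m')) (int n' - 1)) = A_mat (Suc n') (int m')"
      using less[of m n'] 3 by simp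
    \<comment> \<open>These turn the sizes of the flipped zero and identity blocks into those of the
      decomposition with \<open>m'\<close> and \<open>n'\<close> swapped.\<close>
    have choose: "(m' + n' + 2) choose n' = (m' + n' + 2) choose (m' + 2)"
      "(m' + n' + 2) choose (n' + 2) = (m' + n' + 2) choose m'"
      "(m' + n' + 2) choose (n' + 1) = (m' + n' + 2) choose (m' + 1)"
      by (subst binomial_symmetric; simp)+
    have car: "A_mat (Suc (Suc m')) (int n' - 1) \<in>
        carrier_mat ((m' + n' + 2) choose n') ((m' + n' + 2) choose (n' + 1))"
      "A_mat (Suc m') (int n') \<in>
        carrier_mat ((m' + n' + 2) choose (n' + 1)) ((m' + n' + 2) choose (n' + 2))"
      using A_mat_carrier[of "Suc (Suc m')" n'] A_mat_carrier[of "Suc m'" "Suc n'"] by simp_all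
    have "flip_transpose (A_mat (Suc (Suc m')) (int n')) = A_mat (Suc (Suc n')) (int m')"
      unfolding A_mat_Suc_Suc
        flip_transpose_four_block_mat[OF car(1) zero_carrier_mat one_carrier_mat car(2)]
        flip_transpose_zero flip_transpose_one IH1 IH2
      unfolding choose by (simp add: add.commute)
    with 3 show ?thesis by simp
  qed
qed

lemma persymmetric_similar_transpose:
  fixes A :: "'a :: comm_ring_1 mat"
  assumes A: "A \<in> carrier_mat n n" and "persymmetric A"
  shows "\<exists>P. permutation_matrix P \<and> similar_mat_wit (transpose_mat A) A P P"
proof -
  define P :: "'a mat" where "P = mat n n (\<lambda>(i, j). if i = n - 1 - j then 1 else 0)"
  have P: "P \<in> carrier_mat n n"
    by (simp add: P_def)
  have left: "(P * M) $$ (i, j) = M $$ (n - 1 - i, j)"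
    if "M \<in> carrier_mat n n" "i < n" "j < n" for M i j
  proof -
    have "(P * M) $$ (i, j) = (\<Sum>l<n. (if i = n - 1 - l then 1 else 0) * M $$ (l, j))"
      using that by (auto simp: P_def scalar_prod_def lessThan_atLeast0)
    \<comment> \<open>Reversal is an involution on the indices below \<open>n\<close>, so the
      condition can be solved for \<open>l\<close>, leaving one summand.\<close>
    also have "\<dots> = (\<Sum>l<n. if l = n - 1 - i then M $$ (l, j) else 0)"
      using that by (intro sum.cong) auto
    finally show ?thesis using that by simp
  qed
  have right: "(M * P) $$ (i, j) = M $$ (i, n - 1 - j)"
    if "M \<in> carrier_mat n n" "i < n" "j < n" for M i j
  proof -
    have "(M * P) $$ (i, j) = (\<Sum>l<n. M $$ (i, l) * (if l = n - 1 - j then 1 else 0))"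
      using that by (auto simp: P_def scalar_prod_def lessThan_atLeast0)
    also have "\<dots> = (\<Sum>l<n. if l = n - 1 - j then M $$ (i, l) else 0)"
      by (intro sum.cong) auto
    finally show ?thesis using that by simp
  qed
  have "P * P = 1\<^sub>m n"
    by (rule eq_matI) (use P in \<open>auto simp: left simp del: index_mult_mat(1), auto simp: P_def\<close>)
  moreover have "transpose_mat A = P * A * P"
  proof (rule eq_matI)
    fix i j assume "i < dim_row (P * A * P)" "j < dim_col (P * A * P)"
    then have ij: "i < n" "j < n" using P by auto
    have "A $$ (j, i) = flip_transpose A $$ (j, i)"
      using assms(2) by (simp add: persymmetric_def)
    also have "\<dots> = A $$ (n - 1 - i, n - 1 - j)"
      using A ij by (auto simp: flip_transpose_def)
    also have "\<dots> = (P * A * P) $$ (i, j)"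
      using A P ij by (simp add: left right del: index_mult_mat(1))
    finally show "transpose_mat A $$ (i, j) = (P * A * P) $$ (i, j)"
      using A ij by simp
  qed (use A P in auto)
  ultimately have "similar_mat_wit (transpose_mat A) A P P"
    using A P by (auto simp: similar_mat_wit_def Let_def)
  moreover have "permutation_matrix P"
  proof -
    \<comment> \<open>\<open>permutes\<close> demands the identity outside the index range, where
      the bare subtraction would give 0.\<close>
    define \<sigma> where "\<sigma> = (\<lambda>i. if i < n then n - 1 - i else i)"
    have "bij_betw \<sigma> {..<n} {..<n}"
      by (rule bij_betw_byWitness[where f' = \<sigma>]) (auto simp: \<sigma>_def)
    then have "\<sigma> permutes {..<n}"
      by (rule bij_imp_permutes) (simp add: \<sigma>_def)
    moreover have "P = mat n n (\<lambda>(i, j). if i = \<sigma> j then 1 else 0)"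
      by (rule eq_matI) (auto simp: P_def \<sigma>_def)
    ultimately show ?thesis unfolding permutation_matrix_def by blast
  qed
  ultimately show ?thesis by blast
qed

theorem corollary3p9:
  fixes k :: nat
  assumes "k \<ge> 1"
  shows "square_mat (A_mat k (int k - 2)) \<and>
    persymmetric (A_mat k (int k - 2)) \<and>
    (\<exists>P Q. permutation_matrix P \<and>
       similar_mat_wit (transpose_mat (A_mat k (int k - 2))) (A_mat k (int k - 2)) Q P)"
proof -
  have "(2 * k - 1) choose (k - 1) = (2 * k - 1) choose k"
    using assms by (subst binomial_symmetric) (auto intro: arg_cong)
  then have car: "A_mat k (int k - 2) \<in> carrier_mat ((2 * k - 1) choose k) ((2 * k - 1) choose k)"
    using A_mat_square_order[OF assms] by simp
  \<comment> \<open>The matrix is the fixed point \<open>m = n = k - 1\<close> of the swap.\<close>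
  moreover have pers: "persymmetric (A_mat k (int k - 2))"
    using flip_transpose_A_mat[of "k - 1" "k - 1"] assms
    by (simp add: persymmetric_def of_nat_diff)
  ultimately show ?thesis
    using persymmetric_similar_transpose[OF car pers] by auto
qed

end
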